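(* Let $B \subset \mathbb{R}^d$ be a convex body and let $C_1, \ldots, C_n \subset \mathbb{R}^d$ be convex sets that permit a translative covering of $B$. Assume that for every $i \in \{1,\ldots,n\}$ there exists some $o_i \in \mathbb{R}^d$ such that $r_B(C_i) B - o_i$ and $C_i - o_i$ have a complete set of contact pairs all of which are of the form $(u,u)$. Then $$\sum_{i=1}^n r_B(C_i) \ge 1.$$
   Context: A convex body is a compact convex set with nonempty interior. Convex sets $C_1,\ldots,C_n \subset \mathbb{R}^d$ permit a translative covering of a convex body $B$ if $B \subset \bigcup_{i=1}^n (C_i + x_i)$ for some $x_1,\ldots,x_n \in \mathbb{R}^d$. For a convex body $K \subset \mathbb{R}^d$ and a convex set $L \subset \mathbb{R}^d$, the $K$-inradius of $L$ is $r_K(L) = \sup\{\lambda \ge 0 : \lambda K + x \subset L \text{ for some } x \in \mathbb{R}^d\}$. Contact pairs: let $K'$ be a maximal homothetic copy of a convex body $K$ inscribed in a convex set $L$ (i.e. $K' \subset L$ is a translate of $r_K(L) K$). A contact pair of $K'$ and $L$ is a pair $(u,v)$ with $u \in \mathbb{R}^d$, $v \in \mathbb{R}^d \setminus \{0\}$, where $u$ is a common boundary point of $K'$ and $L$ and $v$ is a common outer normal vector of $K'$ and $L$ at $u$ (i.e. $\langle x, v\rangle \le \langle u, v \rangle$ for all $x \in L$, hence for all $x \in K'$). A finite set of contact pairs $\{(u_1,v_1),\ldots,(u_m,v_m)\}$ is complete if $0 \in \operatorname{conv}\{v_1,\ldots,v_m\}$. In the hypothesis, these notions are applied with $K = B$,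 $K' = r_B(C_i)B - o_i$ and $L = C_i - o_i$. *)

theory Defs
  imports "HOL-Analysis.Analysis"
begin

text \<open>The space \<open>\<real>\<^sup>d\<close> is an arbitrary type of class \<^class>\<open>euclidean_space\<close>.\<close>

abbreviation translate :: "'a::euclidean_space \<Rightarrow> 'a set \<Rightarrow> 'a set" where
  "translate x A \<equiv> (\<lambda>y. y + x) ` A"

abbreviation dilate :: "real \<Rightarrow> 'a::euclidean_space set \<Rightarrow> 'a set" where
  "dilate c A \<equiv> (\<lambda>y. c *\<^sub>R y) ` A"

definition convex_body :: "'a::euclidean_space set \<Rightarrow> bool" where
  "convex_body K \<longleftrightarrow> compact K \<and> convex K \<and> interior K \<noteq> {}"

definition permit_translative_covering ::
    "nat \<Rightarrow> (nat \<Rightarrow> 'a::euclidean_space set) \<Rightarrow> 'a set \<Rightarrow> bool" where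
  "permit_translative_covering n C B \<longleftrightarrow>
     (\<exists>x. B \<subseteq> (\<Union>i\<in>{1..n}. translate (x i) (C i)))"

definition homothety_ratios :: "'a::euclidean_space set \<Rightarrow> 'a set \<Rightarrow> real set" where
  "homothety_ratios K L = {c. c \<ge> 0 \<and> (\<exists>x. translate x (dilate c K) \<subseteq> L)}"

text \<open>
  The supremum is taken in the reals, so \<open>inradius K L\<close> is meaningful only if
  \<open>homothety_ratios K L\<close> is nonempty and bounded above. This holds whenever \<open>L\<close> has a
  complete set of contact pairs; see \<open>complete_contact_pairs_bdd_above\<close> below.
\<close>

definition inradius :: "'a::euclidean_space set \<Rightarrow> 'a set \<Rightarrow> real" where
  "inradius K L = Sup (homothety_ratios K L)"

definition maximal_homothetic_copy ::
    "'a::euclidean_space set \<Rightarrow> 'a set \<Rightarrow> 'a set \<Rightarrow> bool" where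
  "maximal_homothetic_copy K K' L \<longleftrightarrow>
     K' \<subseteq> L \<and> (\<exists>x. K' = translate x (dilate (inradius K L) K))"

definition outer_normal :: "'a::euclidean_space set \<Rightarrow> 'a \<Rightarrow> 'a \<Rightarrow> bool" where
  "outer_normal A u v \<longleftrightarrow> v \<noteq> 0 \<and> (\<forall>x\<in>A. x \<bullet> v \<le> u \<bullet> v)"

definition contact_pair ::
    "'a::euclidean_space set \<Rightarrow> 'a set \<Rightarrow> 'a \<times> 'a \<Rightarrow> bool" where
  "contact_pair K' L = (\<lambda>(u, v).
     u \<in> frontier K' \<and> u \<in> frontier L \<and> outer_normal K' u v \<and> outer_normal L u v)"

definition complete_contact_pairs ::
    "'a::euclidean_space set \<Rightarrow> 'a set \<Rightarrow> 'a set \<Rightarrow> ('a \<times> 'a) set \<Rightarrow> bool" where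
  "complete_contact_pairs K K' L S \<longleftrightarrow>
     maximal_homothetic_copy K K' L \<and> finite S \<and> (\<forall>p\<in>S. contact_pair K' L p) \<and>
     0 \<in> convex hull (snd ` S)"

lemma complete_contact_pairs_nonempty:
  assumes "convex_body K" and "complete_contact_pairs K K' L S"
  shows "homothety_ratios K L \<noteq> {}"
proof -
  have "K \<noteq> {}"
    using assms(1) interior_subset by (fastforce simp: convex_body_def)
  then have "L \<noteq> {}"
    using assms(2) by (auto simp: complete_contact_pairs_def maximal_homothetic_copy_def)
  then obtain x where "x \<in> L" by blast
  then have "0 \<in> homothety_ratios K L"
    by (auto simp: homothety_ratios_def intro!: exI[of _ x])
  then show ?thesis by blast
qed

lemma complete_contact_pairs_bdd_above:
  fixes K :: "'a::euclidean_space set"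
  assumes K: "convex_body K" and S: "complete_contact_pairs K K' L S"
  shows "bdd_above (homothety_ratios K L)"
proof -
  let ?V = "snd ` S"
  have fin: "finite ?V" and hull: "0 \<in> convex hull ?V"
    using S by (auto simp: complete_contact_pairs_def)
  have "\<forall>v\<in>?V. \<exists>h. v \<noteq> 0 \<and> (\<forall>x\<in>L. x \<bullet> v \<le> h)"
    using S by (fastforce simp: complete_contact_pairs_def contact_pair_def outer_normal_def)
  then obtain h where h: "\<And>v. v \<in> ?V \<Longrightarrow> v \<noteq> 0"
      "\<And>v x. v \<in> ?V \<Longrightarrow> x \<in> L \<Longrightarrow> x \<bullet> v \<le> h v"
    by metis
  obtain a where a: "\<And>v. v \<in> ?V \<Longrightarrow> a v \<ge> (0::real)" "sum a ?V = 1"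
      "(\<Sum>v\<in>?V. a v *\<^sub>R v) = 0"
    using hull unfolding convex_hull_finite[OF fin] by auto
  have "\<exists>v\<in>?V. a v \<noteq> 0"
    using a(2) by (metis sum.neutral zero_neq_one)
  then obtain v where v: "v \<in> ?V" "a v > 0"
    using a(1) by (metis order_le_less)
  define m where "m = (\<Sum>w\<in>?V - {v}. a w * h w)"
  have low: "- m \<le> a v * (x \<bullet> v)" if "x \<in> L" for x
  proof -
    have "0 = x \<bullet> (\<Sum>w\<in>?V. a w *\<^sub>R w)" using a(3) by simp
    also have "\<dots> = (\<Sum>w\<in>?V. a w * (x \<bullet> w))" by (simp add: inner_sum_right)
    also have "\<dots> = a v * (x \<bullet> v) + (\<Sum>w\<in>?V - {v}. a w * (x \<bullet> w))"
      using fin v(1) by (rule sum.remove)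
    also have "\<dots> \<le> a v * (x \<bullet> v) + m"
      unfolding m_def
      by (intro add_left_mono sum_mono mult_left_mono) (use a(1) h(2) that in auto)
    finally show ?thesis by simp
  qed
  obtain z where "z \<in> interior K" using K by (auto simp: convex_body_def)
  then obtain e where e: "e > 0" "cball z e \<subseteq> K" by (auto simp: mem_interior_cball)
  define y where "y = z + (e / norm v) *\<^sub>R v"
  have nv: "norm v > 0" using h(1) v(1) by simp
  have "y \<in> cball z e" using e nv by (simp add: y_def dist_norm)
  then have zy: "z \<in> K" "y \<in> K" using e by auto
  have diff: "y \<bullet> v - z \<bullet> v = e * norm v"
    using nv by (simp add: y_def inner_add_left dot_square_norm power2_eq_square)
  show ?thesis
  proof (rule bdd_aboveI)
    fix c assume "c \<in> homothety_ratios K L"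
    then obtain x where x: "c \<ge> 0" "translate x (dilate c K) \<subseteq> L"
      by (auto simp: homothety_ratios_def)
    have in_L: "c *\<^sub>R z + x \<in> L" "c *\<^sub>R y + x \<in> L" using zy x(2) by auto
    have "a v * ((c *\<^sub>R y + x) \<bullet> v) \<le> a v * h v"
      using h(2)[OF v(1) in_L(2)] v(2) by simp
    then have "a v * ((c *\<^sub>R y + x) \<bullet> v) - a v * ((c *\<^sub>R z + x) \<bullet> v) \<le> a v * h v + m"
      using low[OF in_L(1)] by linarith
    moreover have "a v * ((c *\<^sub>R y + x) \<bullet> v) - a v * ((c *\<^sub>R z + x) \<bullet> v)
        = a v * (c * (y \<bullet> v - z \<bullet> v))"
      by (simp add: inner_add_left algebra_simps)
    ultimately have "c * (a v * (e * norm v)) \<le> a v * h v + m"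
      unfolding diff by (simp add: mult_ac)
    then show "c \<le> (a v * h v + m) / (a v * (e * norm v))"
      using v(2) e(1) nv by (simp add: pos_le_divide_eq)
  qed
qed

end

theory Submission
  imports Defs
begin

text \<open>
  Bang's argument. Write \<open>r\<^sub>i\<close> for the inradii and \<open>U\<^sub>i\<close> for the finite set of contact points of
  \<open>r\<^sub>i B - o\<^sub>i\<close> and \<open>C\<^sub>i - o\<^sub>i\<close>; then \<open>C\<^sub>i - o\<^sub>i\<close> lies in the polyhedron \<open>{x. \<forall>u\<in>U\<^sub>i. x \<bullet> u \<le> u \<bullet> u}\<close>.
  For suitable \<open>w\<^sub>i \<in> U\<^sub>i\<close> the point \<open>\<Sum>\<^sub>i w\<^sub>i\<close> avoids the interiors of all prescribed
  translates of these polyhedra. If \<open>\<Sum>\<^sub>i r\<^sub>i < 1\<close>, there is room in \<open>B\<close> to stretch the \<open>w\<^sub>i\<close> by a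
  factor \<open>t > 1\<close>, and the stretched sum gives a point of \<open>B\<close> that is not covered.
\<close>

text \<open>
  The selection maximizes \<open>\<Sum>\<^bsub>i\<noteq>j\<^esub> w\<^sub>i \<bullet> w\<^sub>j - 2 (\<Sum>\<^sub>i w\<^sub>i \<bullet> y\<^sub>i)\<close>. Leaving out the diagonal terms of
  \<open>(norm (\<Sum>\<^sub>i w\<^sub>i))\<^sup>2\<close> makes the functional affine in each \<open>w\<^sub>i\<close>, so that contact points of different
  lengths are harmless.
\<close>

lemma bang_selection:
  fixes U :: "'i \<Rightarrow> 'a::real_inner set" and y :: "'i \<Rightarrow> 'a"
  assumes I: "finite I" and fin: "\<And>i. i \<in> I \<Longrightarrow> finite (U i)"
    and hull: "\<And>i. i \<in> I \<Longrightarrow> 0 \<in> convex hull (U i)"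
  shows "\<exists>w. \<forall>i\<in>I. w i \<in> U i \<and> w i \<bullet> w i \<le> ((\<Sum>j\<in>I. w j) - y i) \<bullet> w i"
proof -
  define f where "f w = (\<Sum>j\<in>I. w j) \<bullet> (\<Sum>j\<in>I. w j) - (\<Sum>j\<in>I. w j \<bullet> w j + 2 * (w j \<bullet> y j))"
    for w
  have "U i \<noteq> {}" if "i \<in> I" for i
    using hull[OF that] by auto
  then have "finite (f ` PiE I U)" "f ` PiE I U \<noteq> {}"
    using I fin by (auto simp: finite_PiE PiE_eq_empty_iff)
  then have "Max (f ` PiE I U) \<in> f ` PiE I U" "\<And>w'. w' \<in> PiE I U \<Longrightarrow> f w' \<le> Max (f ` PiE I U)"
    by auto
  then obtain w where w: "w \<in> PiE I U" and max: "\<And>w'. w' \<in> PiE I U \<Longrightarrow> f w' \<le> f w"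
    by auto
  have "w i \<bullet> w i \<le> ((\<Sum>j\<in>I. w j) - y i) \<bullet> w i" if i: "i \<in> I" for i
  proof -
    define X where "X = (\<Sum>j\<in>I - {i}. w j)"
    define R where "R = (\<Sum>j\<in>I - {i}. w j \<bullet> w j + 2 * (w j \<bullet> y j))"
    have f_upd: "f (w(i := u)) = X \<bullet> X - R + 2 * ((X - y i) \<bullet> u)" for u
    proof -
      have "(\<Sum>j\<in>I. (w(i := u)) j) = u + X"
        unfolding X_def sum.remove[OF I i] by (auto intro!: sum.cong)
      moreover have "(\<Sum>j\<in>I. (w(i := u)) j \<bullet> (w(i := u)) j + 2 * ((w(i := u)) j \<bullet> y j))
          = u \<bullet> u + 2 * (u \<bullet> y i) + R"
        unfolding R_def sum.remove[OF I i] by (auto intro!: sum.cong)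
      ultimately show ?thesis
        by (simp add: f_def inner_commute algebra_simps)
    qed
    have "(X - y i) \<bullet> u \<le> (X - y i) \<bullet> w i" if "u \<in> U i" for u
    proof -
      have "w(i := u) \<in> PiE I U"
        using w i that by (auto simp: PiE_iff extensional_def)
      from max[OF this] show ?thesis
        using f_upd[of u] f_upd[of "w i"] by simp
    qed
    \<comment> \<open>By maximality \<open>w i\<close> maximizes the linear form
      \<open>(X - y i) \<bullet> u\<close> over \<open>U i\<close>, hence over its hull; that hull
      contains 0, so the maximum is nonnegative.\<close>
    then have "convex hull (U i) \<subseteq> {x. (X - y i) \<bullet> x \<le> (X - y i) \<bullet> w i}"
      by (intro hull_minimal convex_halfspace_le) auto
    with hull[OF i] have "0 \<le> (X - y i) \<bullet> w i"
      by auto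
    moreover have "(\<Sum>j\<in>I. w j) = w i + X"
      unfolding X_def using I i by (rule sum.remove)
    ultimately show ?thesis
      by (simp add: algebra_simps)
  qed
  with w show ?thesis
    by (intro exI[of _ w]) (auto simp: PiE_iff)
qed

text \<open>Contact pairs are given for a translate of \<open>L\<close>, while the inradius refers
  to \<open>L\<close> itself; this carries boundedness of the ratios from one to the other.\<close>

lemma homothety_ratios_translate:
  "homothety_ratios K (translate p L) = homothety_ratios K L"
proof -
  have "homothety_ratios K L \<subseteq> homothety_ratios K (translate p L)" for L p
  proof
    fix c assume "c \<in> homothety_ratios K L"
    then obtain x where "c \<ge> 0" and x: "translate x (dilate c K) \<subseteq> L"
      by (auto simp: homothety_ratios_def)
    moreover have "translate (x + p) (dilate c K) \<subseteq> translate p L"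
      using image_mono[OF x, of "\<lambda>y. y + p"] by (simp add: image_image add.assoc)
    ultimately show "c \<in> homothety_ratios K (translate p L)"
      unfolding homothety_ratios_def by blast
  qed
  from this[of L p] this[of "translate p L" "- p"] show ?thesis
    by (simp add: image_image)
qed

lemma inradius_nonneg:
  assumes "L \<noteq> {}" and "bdd_above (homothety_ratios K L)"
  shows "0 \<le> inradius K L"
proof -
  obtain x where "x \<in> L" using assms(1) by blast
  then have "0 \<in> homothety_ratios K L"
    by (auto simp: homothety_ratios_def intro!: exI[of _ x])
  then show ?thesis
    unfolding inradius_def using assms(2) by (rule cSup_upper)
qed

text \<open>When each contact point is its own normal, completeness puts 0 in the hull of the
  contact points, and the supporting inequality at \<open>u\<close> becomes
  \<open>(x - p) \<bullet> u \<le> u \<bullet> u\<close>.\<close>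

lemma complete_contact_pairs_diagonal:
  fixes B L :: "'a::euclidean_space set"
  assumes B: "convex_body B"
    and S: "complete_contact_pairs B (translate (- p) (dilate (inradius B L) B)) (translate (- p) L) S"
    and diag: "\<forall>(u, v)\<in>S. v = u"
  obtains U where "0 \<le> inradius B L" "finite U" "0 \<in> convex hull U"
    "\<And>u. u \<in> U \<Longrightarrow> u \<noteq> 0 \<and> (\<exists>b\<in>B. u = inradius B L *\<^sub>R b - p) \<and> (\<forall>x\<in>L. (x - p) \<bullet> u \<le> u \<bullet> u)"
proof
  let ?K = "translate (- p) (dilate (inradius B L) B)"
  have "L \<noteq> {}"
    using complete_contact_pairs_nonempty[OF B S] B
    by (auto simp: homothety_ratios_def convex_body_def)
  then show "0 \<le> inradius B L"
    using complete_contact_pairs_bdd_above[OF B S]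
    unfolding homothety_ratios_translate by (rule inradius_nonneg)
  show "finite (snd ` S)" "0 \<in> convex hull (snd ` S)"
    using S by (auto simp: complete_contact_pairs_def)
  fix u assume "u \<in> snd ` S"
  then have "contact_pair ?K (translate (- p) L) (u, u)"
    using S diag by (fastforce simp: complete_contact_pairs_def)
  then have u: "u \<in> frontier ?K" "outer_normal (translate (- p) L) u u"
    by (auto simp: contact_pair_def)
  \<comment> \<open>Closedness of the copy is what lets a frontier point \<open>u\<close> be written
    as \<open>inradius B L *\<^sub>R b - p\<close> with \<open>b\<close> in
    \<open>B\<close>.\<close>
  have "compact ?K"
    using B by (intro compact_continuous_image continuous_intros) (simp add: convex_body_def)
  then have "u \<in> ?K"
    using u(1) frontier_subset_closed compact_imp_closed by blast
  with u(2) show "u \<noteq> 0 \<and> (\<exists>b\<in>B. u = inradius B L *\<^sub>R b - p) \<and> (\<forall>x\<in>L. (x - p) \<bullet> u \<le> u \<bullet> u)"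
    by (auto simp: outer_normal_def)
qed

theorem corollary2:
  fixes B :: "'a::euclidean_space set" and C :: "nat \<Rightarrow> 'a set" and n :: nat
  assumes "convex_body B"
    and "\<And>i. i \<in> {1..n} \<Longrightarrow> convex (C i)"
    and "permit_translative_covering n C B"
    and "\<And>i. i \<in> {1..n} \<Longrightarrow>
           \<exists>p S. complete_contact_pairs B
                   (translate (- p) (dilate (inradius B (C i)) B)) (translate (- p) (C i)) S
                 \<and> (\<forall>(u, v)\<in>S. v = u)"
  shows "(\<Sum>i\<in>{1..n}. inradius B (C i)) \<ge> 1"
proof (rule ccontr)
  let ?I = "{1..n}"
  define r where "r i = inradius B (C i)" for i
  define s where "s = (\<Sum>i\<in>?I. r i)"
  assume "\<not> ?thesis"
  then have s: "s < 1" by (simp add: s_def r_def)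
  have "\<forall>i\<in>?I. \<exists>p U. 0 \<le> r i \<and> finite U \<and> 0 \<in> convex hull U \<and>
      (\<forall>u\<in>U. u \<noteq> 0 \<and> (\<exists>b\<in>B. u = r i *\<^sub>R b - p) \<and> (\<forall>x\<in>C i. (x - p) \<bullet> u \<le> u \<bullet> u))"
  proof
    fix i assume "i \<in> ?I"
    from assms(4)[OF this] obtain p S where
      S: "complete_contact_pairs B (translate (- p) (dilate (r i) B)) (translate (- p) (C i)) S"
        "\<forall>(u, v)\<in>S. v = u"
      unfolding r_def by blast
    show "\<exists>p U. 0 \<le> r i \<and> finite U \<and> 0 \<in> convex hull U \<and>
      (\<forall>u\<in>U. u \<noteq> 0 \<and> (\<exists>b\<in>B. u = r i *\<^sub>R b - p) \<and> (\<forall>x\<in>C i. (x - p) \<bullet> u \<le> u \<bullet> u))"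
      using complete_contact_pairs_diagonal[OF assms(1) S[unfolded r_def]]
      unfolding r_def by metis
  qed
  then obtain p U where r: "\<And>i. i \<in> ?I \<Longrightarrow> 0 \<le> r i"
    and U: "\<And>i. i \<in> ?I \<Longrightarrow> finite (U i)" "\<And>i. i \<in> ?I \<Longrightarrow> 0 \<in> convex hull (U i)"
    and contact: "\<And>i u. i \<in> ?I \<Longrightarrow> u \<in> U i \<Longrightarrow>
      u \<noteq> 0 \<and> (\<exists>b\<in>B. u = r i *\<^sub>R b - p i) \<and> (\<forall>x\<in>C i. (x - p i) \<bullet> u \<le> u \<bullet> u)"
    by metis
  obtain z where cover: "B \<subseteq> (\<Union>i\<in>?I. translate (z i) (C i))"
    using assms(3) by (auto simp: permit_translative_covering_def)
  obtain b0 where b0: "b0 \<in> B"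
    using assms(1) interior_subset by (fastforce simp: convex_body_def)
  have "0 \<le> s" unfolding s_def using r by (rule sum_nonneg)
  \<comment> \<open>Any \<open>t > 1\<close> with \<open>t * s \<le> 1\<close> would do; this choice
    also covers \<open>s = 0\<close>.\<close>
  define t where "t = 2 / (1 + s)"
  have t: "t > 1" "t * s \<le> 1"
    using s \<open>0 \<le> s\<close> by (auto simp: t_def field_simps)
  \<comment> \<open>The shift cancels the \<open>p i\<close>, so that the stretched sum plus
    \<open>c\<close> is a convex combination of \<open>b0\<close> and points of \<open>B\<close>,
    with weights \<open>1 - t * s\<close> and \<open>t * r i\<close>.\<close>
  define c where "c = t *\<^sub>R (\<Sum>i\<in>?I. p i) + (1 - t * s) *\<^sub>R b0"
  \<comment> \<open>With the origin moved to \<open>c\<close>, the \<open>i\<close>-th covering set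
    becomes \<open>C i - p i\<close> shifted by \<open>y i\<close>.\<close>
  define y where "y i = z i + p i - c" for i
  \<comment> \<open>The shifts are divided by \<open>t\<close> because the selected sum is stretched
    by \<open>t\<close> afterwards.\<close>
  have "\<exists>w. \<forall>i\<in>?I. w i \<in> U i \<and> w i \<bullet> w i \<le> ((\<Sum>j\<in>?I. w j) - y i /\<^sub>R t) \<bullet> w i"
    by (rule bang_selection) (use U in auto)
  then obtain w where "\<forall>i\<in>?I. w i \<in> U i \<and> w i \<bullet> w i \<le> ((\<Sum>j\<in>?I. w j) - y i /\<^sub>R t) \<bullet> w i"
    by (elim exE)
  then have w: "\<And>i. i \<in> ?I \<Longrightarrow> w i \<in> U i"
      "\<And>i. i \<in> ?I \<Longrightarrow> w i \<bullet> w i \<le> ((\<Sum>j\<in>?I. w j) - y i /\<^sub>R t) \<bullet> w i"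
    by blast+
  obtain b where b: "\<And>i. i \<in> ?I \<Longrightarrow> b i \<in> B" "\<And>i. i \<in> ?I \<Longrightarrow> w i = r i *\<^sub>R b i - p i"
  proof -
    have "\<forall>i\<in>?I. \<exists>b. b \<in> B \<and> w i = r i *\<^sub>R b - p i"
      using contact w(1) by blast
    then show ?thesis using that by metis
  qed
  define x where "x = t *\<^sub>R (\<Sum>j\<in>?I. w j)"
  have "(\<Sum>j\<in>?I. w j) = (\<Sum>j\<in>?I. r j *\<^sub>R b j) - (\<Sum>j\<in>?I. p j)"
    using b(2) by (simp add: sum_subtractf)
  then have "x + c = (1 - t * s) *\<^sub>R b0 + (\<Sum>i\<in>?I. (t * r i) *\<^sub>R b i)"
    by (simp add: x_def c_def scaleR_right_diff_distrib scaleR_sum_right)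
  \<comment> \<open>Index 0 lies outside \<open>{1..n}\<close> and is free to carry
    \<open>b0\<close>.\<close>
  also have "\<dots> = (\<Sum>i\<in>insert 0 ?I. (if i = 0 then 1 - t * s else t * r i) *\<^sub>R
      (if i = 0 then b0 else b i))"
    by (auto intro!: sum.cong)
  also have "\<dots> \<in> B"
  proof (rule convex_sum)
    show "convex B" using assms(1) by (simp add: convex_body_def)
    show "(\<Sum>i\<in>insert 0 ?I. if i = 0 then 1 - t * s else t * r i) = 1"
      by (auto simp: s_def sum_distrib_left intro!: sum.cong)
  qed (use r t b(1) b0 in auto)
  finally obtain i where i: "i \<in> ?I" "x + c \<in> translate (z i) (C i)"
    using cover by blast
  then have "x + c - z i \<in> C i" by auto
  then have "(x + c - z i - p i) \<bullet> w i \<le> w i \<bullet> w i"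
    using contact[OF i(1) w(1)[OF i(1)]] by blast
  moreover have "x + c - z i - p i = x - y i"
    by (simp add: y_def)
  ultimately have "(x - y i) \<bullet> w i \<le> w i \<bullet> w i"
    by simp
  moreover have "x - y i = t *\<^sub>R ((\<Sum>j\<in>?I. w j) - y i /\<^sub>R t)"
    using t(1) by (simp add: x_def scaleR_right_diff_distrib)
  then have "t * (w i \<bullet> w i) \<le> (x - y i) \<bullet> w i"
    using w(2)[OF i(1)] t(1) by simp
  \<comment> \<open>Strict because contact normals are nonzero.\<close>
  moreover have "1 * (w i \<bullet> w i) < t * (w i \<bullet> w i)"
    using contact[OF i(1) w(1)[OF i(1)]] t(1) by (intro mult_strict_right_mono) simp_all
  ultimately show False
    by linarith
qed

end
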